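(* Let $q$ be a prime power. (Multiplicative case.) Let $d$ be a proper divisor of $q-1$ and let $H$ be a multiplicative subgroup of $GF(q)^*$ of size $d$. Let $A = g_0H$ and $B_1 = g_1H$ be arbitrary cosets of $H$ in $GF(q)^*$. Consider the set of points of $PG(2,q)$ $$U = \{(0,h,1) : h \in GF(q),\ h \notin A\} \cup \{(-g,0,1) : g \in B_1\}.$$ Then $U$ determines exactly $q+1-d$ directions. In particular, these directions are all the points of the line at infinity $Z=0$ except those in $W = \{(1,c,0) : c \in C\}$, where $C = \frac{g_0}{g_1}H$. Letting $W_1$ denote the set of directions determined by $U$ (that is, the points of $Z=0$ not in $W$), the set $U \cup W_1$ is a Rédei type blocking set of size $2q+1-d$. (Additive case.) Similarly, let $q>2$, let $d$ be a proper divisor of $q$, let $H$ be a subgroup of $(GF(q),+)$ of order $d$, and let $A$ and $B_1$ be arbitrary cosets of $H$ in $(GF(q),+)$. Put $$U = \{(0,a,1) : a \in GF(q),\ a \notin A\} \cup \{(1,b,1) : b \in B_1\}.$$ Then the union of $U$ with the set of directions determined by $U$ is a Rédei type blocking set of size $2q+1-d$.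
   Context: Points of $PG(2,q)$ are given by homogeneous coordinates $(x,y,z)$; the line at infinity is $Z=0$, and the affine point $(x,y)$ is $(x,y,1)$. A set $U$ of affine points determines a direction $P$ (a point $P$ of the line $Z=0$) if some line joining two distinct points of $U$ meets $Z=0$ in $P$. A (proper) blocking set in $PG(2,q)$ is a set $S$ of points such that every line meets $S$ and $S$ contains no line. It is minimal if it does not properly contain a smaller blocking set, equivalently each of its points lies on a tangent line (a line meeting $S$ only in that point). A Rédei (type) blocking set is a minimal blocking set with $q+n$ points for which the maximum number of its points on a line is $n$; a line containing $n$ of its points is called a Rédei line. *)

theory Defs
  imports "HOL-Analysis.Cartesian_Space" "HOL-Algebra.Coset"
begin

definition field_mult_group :: "'a::field monoid" where
  "field_mult_group = \<lparr>carrier = UNIV - {0}, mult = (*), one = 1\<rparr>"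

definition field_add_group :: "'a::field monoid" where
  "field_add_group = \<lparr>carrier = UNIV, mult = (+), one = 0\<rparr>"

(* Points of PG(2,q) are the one-dimensional subspaces of the three-dimensional coordinate space;
   proj_point x y z is only a point if (x, y, z) is not the zero vector. *)
definition proj_points :: "('a::field ^ 3) set set" where
  "proj_points = {vec.span {v} | v. v \<noteq> 0}"

definition proj_point :: "'a::field \<Rightarrow> 'a \<Rightarrow> 'a \<Rightarrow> ('a ^ 3) set" where
  "proj_point x y z = vec.span {vector [x, y, z]}"

(* The line with equation aX + bY + cZ = 0, as the set of points on it;
   it is only a line if (a, b, c) is not the zero vector. *)
definition proj_line :: "'a::field \<Rightarrow> 'a \<Rightarrow> 'a \<Rightarrow> ('a ^ 3) set set" where
  "proj_line a b c = {P \<in> proj_points. \<forall>v\<in>P. a * v $ 1 + b * v $ 2 + c * v $ 3 = 0}"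

definition proj_lines :: "('a::field ^ 3) set set set" where
  "proj_lines = {proj_line a b c | a b c. \<not> (a = 0 \<and> b = 0 \<and> c = 0)}"

definition line_at_infinity :: "('a::field ^ 3) set set" where
  "line_at_infinity = proj_line 0 0 1"

definition determined_directions :: "('a::field ^ 3) set set \<Rightarrow> ('a ^ 3) set set" where
  "determined_directions U =
    {P \<in> line_at_infinity.
      \<exists>Q\<in>U. \<exists>R\<in>U. Q \<noteq> R \<and> (\<exists>l\<in>proj_lines. Q \<in> l \<and> R \<in> l \<and> P \<in> l)}"

definition blocking_set :: "('a::field ^ 3) set set \<Rightarrow> bool" where
  "blocking_set S \<longleftrightarrow>
    S \<subseteq> proj_points \<and> (\<forall>l\<in>proj_lines. l \<inter> S \<noteq> {}) \<and> (\<forall>l\<in>proj_lines. \<not> l \<subseteq> S)"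

definition minimal_blocking_set :: "('a::field ^ 3) set set \<Rightarrow> bool" where
  "minimal_blocking_set S \<longleftrightarrow> blocking_set S \<and> \<not> (\<exists>T. T \<subset> S \<and> blocking_set T)"

definition redei_blocking_set :: "('a::{field,finite} ^ 3) set set \<Rightarrow> bool" where
  "redei_blocking_set S \<longleftrightarrow>
    minimal_blocking_set S \<and>
    (\<exists>n. card S = CARD('a) + n \<and> Max ((\<lambda>l. card (S \<inter> l)) ` proj_lines) = n)"

end

theory Submission imports Defs begin

text \<open>Let \<open>U\<close> be a set of \<open>q\<close> affine points, and let \<open>D\<close> be the set of directions that it determines.
  If \<open>2 \<le> |D| \<le> q\<close>, then \<open>U \<union> D\<close> is a Redei blocking set with \<open>q + |D|\<close> points
  (\<open>redei_blocking_set_union_directions\<close>). Both constructions are instances of this.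

  The key observation is \<open>not_determined_iff_all_lines_meet\<close>: a point \<open>P\<close> at infinity lies on exactly
  \<open>q\<close> affine lines, so \<open>P\<close> is not determined, that is, each of these lines contains at most one point of
  \<open>U\<close>, if and only if each of them contains at least one point of \<open>U\<close>. Hence an affine line whose
  infinite point is not in \<open>D\<close> meets \<open>U\<close>, and every other line meets \<open>D\<close>. Now fix a direction \<open>N\<close> not
  in \<open>D\<close>. An affine line \<open>l\<close> is not contained in \<open>U \<union> D\<close>, since otherwise the line in direction \<open>N\<close>
  through a point of \<open>U\<close> off \<open>l\<close> would meet \<open>l\<close> in a second point of \<open>U\<close>. The set is minimal because each
  of its points has a tangent: a point of \<open>U\<close> has the line through it in direction \<open>N\<close>, and a point of
  \<open>D\<close> lies, by the observation, on an affine line that misses \<open>U\<close>. The line at infinity meets the set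
  in \<open>|D|\<close> points, and no line does in more, because projecting the points of \<open>U\<close> on an affine line \<open>l\<close>
  from a point of \<open>U\<close> off \<open>l\<close> gives as many directions in \<open>D\<close>, all different from that of \<open>l\<close>
  (\<open>card_line_inter_le_card_directions\<close>).

  In both constructions the vertical direction is determined because at least two points of the line
  \<open>X = 0\<close> are left, and the slopes that are not determined form a coset of \<open>H\<close>, so that
  \<open>|D| = q + 1 - d\<close>.\<close>

section \<open>Incidence in the projective plane\<close>

lemma proj_point_in_proj_points:
  "\<not> (x = 0 \<and> y = 0 \<and> z = 0) \<Longrightarrow> proj_point x y z \<in> proj_points"
  unfolding proj_points_def proj_point_def
  by (auto simp: vec_eq_iff forall_3 intro!: exI[of _ "vector [x, y, z]"])

lemma proj_pointsE:
  assumes "P \<in> proj_points"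
  obtains x y z where "P = proj_point x y z" "\<not> (x = 0 \<and> y = 0 \<and> z = 0)"
proof -
  obtain v where v: "P = vec.span {v}" "v \<noteq> 0"
    using assms unfolding proj_points_def by auto
  have e: "v = vector [v $ 1, v $ 2, v $ 3]"
    by (simp add: vec_eq_iff forall_3)
  show thesis
    using that[of "v $ 1" "v $ 2" "v $ 3"] v e
    unfolding proj_point_def by (auto simp: vec_eq_iff forall_3)
qed

lemma proj_point_in_proj_line_iff:
  assumes "\<not> (x = 0 \<and> y = 0 \<and> z = 0)"
  shows "proj_point x y z \<in> proj_line a b c \<longleftrightarrow> a * x + b * y + c * z = 0"
proof -
  have "a * (k * x) + b * (k * y) + c * (k * z) = k * (a * x + b * y + c * z)" for k
    by (simp add: algebra_simps)
  then show ?thesis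
    using proj_point_in_proj_points[OF assms]
    unfolding proj_line_def proj_point_def
    by (auto simp: vec.span_singleton intro: allE[of _ 1])
qed

lemma proj_point_scale:
  assumes "k \<noteq> 0"
  shows "proj_point (k * x) (k * y) (k * z) = proj_point x y z"
proof -
  have e: "vector [k * x, k * y, k * z] = k *s (vector [x, y, z] :: 'a ^ 3)"
    by (simp add: vec_eq_iff forall_3)
  have "range (\<lambda>j. j *s (k *s (vector [x, y, z] :: 'a ^ 3))) = range (\<lambda>j. j *s vector [x, y, z])"
  proof (intro equalityI image_subsetI)
    fix j :: 'a
    show "j *s (k *s vector [x, y, z]) \<in> range (\<lambda>j. j *s (vector [x, y, z] :: 'a ^ 3))"
      by (intro image_eqI[of _ _ "j * k"]) (auto simp: vector_smult_assoc)
    show "j *s vector [x, y, z] \<in> range (\<lambda>j. j *s (k *s (vector [x, y, z] :: 'a ^ 3)))"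
      using assms by (intro image_eqI[of _ _ "j / k"]) (auto simp: vector_smult_assoc)
  qed
  then show ?thesis
    unfolding proj_point_def e vec.span_singleton .
qed

lemma proj_line_scale:
  assumes "k \<noteq> 0"
  shows "proj_line (k * a) (k * b) (k * c) = proj_line a b c"
proof -
  have "k * a * x + k * b * y + k * c * z = k * (a * x + b * y + c * z)" for x y z
    by (simp add: algebra_simps)
  with assms show ?thesis
    unfolding proj_line_def by auto
qed

text \<open>If the cross product of two nonzero vectors vanishes, then they are proportional.\<close>

lemma cross_zero_imp_proportional:
  fixes x y z x' y' z' :: "'a::field"
  assumes "y * z' = z * y'" "z * x' = x * z'" "x * y' = y * x'"
    and "\<not> (x = 0 \<and> y = 0 \<and> z = 0)" "\<not> (x' = 0 \<and> y' = 0 \<and> z' = 0)"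
  obtains k where "k \<noteq> 0" "x' = k * x" "y' = k * y" "z' = k * z"
proof -
  consider "x \<noteq> 0" | "y \<noteq> 0" | "z \<noteq> 0"
    using assms(4) by blast
  then show thesis
  proof cases
    case 1
    show thesis
      using 1 assms by (intro that[of "x' / x"]) (auto simp: field_simps)
  next
    case 2
    show thesis
      using 2 assms by (intro that[of "y' / y"]) (auto simp: field_simps)
  next
    case 3
    show thesis
      using 3 assms by (intro that[of "z' / z"]) (auto simp: field_simps)
  qed
qed

lemma exists_joining_line:
  assumes "P \<in> proj_points" "Q \<in> proj_points" "P \<noteq> Q"
  obtains l where "l \<in> proj_lines" "P \<in> l" "Q \<in> l"
proof -
  obtain x y z where P: "P = proj_point x y z" "\<not> (x = 0 \<and> y = 0 \<and> z = 0)"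
    using assms(1) by (rule proj_pointsE)
  obtain x' y' z' where Q: "Q = proj_point x' y' z'" "\<not> (x' = 0 \<and> y' = 0 \<and> z' = 0)"
    using assms(2) by (rule proj_pointsE)
  let ?a = "y * z' - z * y'" and ?b = "z * x' - x * z'" and ?c = "x * y' - y * x'"
  have "\<not> (?a = 0 \<and> ?b = 0 \<and> ?c = 0)"
  proof
    assume "?a = 0 \<and> ?b = 0 \<and> ?c = 0"
    then obtain k where "k \<noteq> 0" "x' = k * x" "y' = k * y" "z' = k * z"
      using P(2) Q(2) cross_zero_imp_proportional[of y z' z y' x' x] by auto
    then show False
      using assms(3) P Q proj_point_scale by metis
  qed
  then have "proj_line ?a ?b ?c \<in> proj_lines"
    unfolding proj_lines_def by blast
  moreover have "P \<in> proj_line ?a ?b ?c" "Q \<in> proj_line ?a ?b ?c"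
    unfolding P(1) Q(1) proj_point_in_proj_line_iff[OF P(2)] proj_point_in_proj_line_iff[OF Q(2)]
    by (simp_all add: algebra_simps)
  ultimately show thesis
    by (rule that)
qed

lemma lines_meet_in_unique_point:
  assumes "l \<in> proj_lines" "m \<in> proj_lines" "l \<noteq> m"
  shows "\<exists>!P. P \<in> l \<and> P \<in> m"
proof -
  obtain a b c where l: "l = proj_line a b c" "\<not> (a = 0 \<and> b = 0 \<and> c = 0)"
    using assms(1) unfolding proj_lines_def by auto
  obtain a' b' c' where m: "m = proj_line a' b' c'" "\<not> (a' = 0 \<and> b' = 0 \<and> c' = 0)"
    using assms(2) unfolding proj_lines_def by auto
  let ?x = "b * c' - c * b'" and ?y = "c * a' - a * c'" and ?z = "a * b' - b * a'"
  have nz: "\<not> (?x = 0 \<and> ?y = 0 \<and> ?z = 0)"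
  proof
    assume "?x = 0 \<and> ?y = 0 \<and> ?z = 0"
    then obtain k where "k \<noteq> 0" "a' = k * a" "b' = k * b" "c' = k * c"
      using l(2) m(2) cross_zero_imp_proportional[of b c' c b' a' a] by auto
    then show False
      using assms(3) l m proj_line_scale by metis
  qed
  show ?thesis
  proof (intro ex1I[of _ "proj_point ?x ?y ?z"] conjI)
    show "proj_point ?x ?y ?z \<in> l" "proj_point ?x ?y ?z \<in> m"
      unfolding l(1) m(1) proj_point_in_proj_line_iff[OF nz] by (simp_all add: algebra_simps)
  next
    fix P assume P: "P \<in> l \<and> P \<in> m"
    then have "P \<in> proj_points"
      unfolding l(1) proj_line_def by blast
    then obtain u v w where uvw: "P = proj_point u v w" "\<not> (u = 0 \<and> v = 0 \<and> w = 0)"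
      by (rule proj_pointsE)
    have e: "a * u + b * v + c * w = 0" "a' * u + b' * v + c' * w = 0"
      using P unfolding l(1) m(1) uvw(1) proj_point_in_proj_line_iff[OF uvw(2)] by auto
    \<comment> \<open>Both (u,v,w) and the cross product are orthogonal to the two coefficient vectors.\<close>
    have "?y * w = ?z * v" "?z * u = ?x * w" "?x * v = ?y * u"
      using e by algebra+
    then obtain k where "k \<noteq> 0" "u = k * ?x" "v = k * ?y" "w = k * ?z"
      using cross_zero_imp_proportional[OF _ _ _ nz uvw(2)] by metis
    then show "P = proj_point ?x ?y ?z"
      unfolding uvw(1) by (metis proj_point_scale)
  qed
qed

lemma joining_line_unique:
  assumes "l \<in> proj_lines" "m \<in> proj_lines" "P \<noteq> Q" "P \<in> l" "Q \<in> l" "P \<in> m" "Q \<in> m"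
  shows "l = m"
  using assms lines_meet_in_unique_point by metis

lemma line_subset_proj_points: "l \<in> proj_lines \<Longrightarrow> l \<subseteq> proj_points"
  unfolding proj_lines_def proj_line_def by auto

lemma line_at_infinity_in_proj_lines: "line_at_infinity \<in> proj_lines"
  unfolding proj_lines_def line_at_infinity_def
  by (rule CollectI, rule exI[of _ 0], rule exI[of _ 0], rule exI[of _ 1]) auto

lemma line_at_infinity_eq:
  "line_at_infinity = insert (proj_point 0 1 0) (range (\<lambda>c. proj_point 1 c 0))"
proof (intro equalityI subsetI)
  fix P :: "('a ^ 3) set"
  assume P: "P \<in> line_at_infinity"
  then have "P \<in> proj_points"
    using line_at_infinity_in_proj_lines line_subset_proj_points by blast
  then obtain x y z where xyz: "P = proj_point x y z" "\<not> (x = 0 \<and> y = 0 \<and> z = 0)"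
    by (rule proj_pointsE)
  have z: "z = 0"
    using P proj_point_in_proj_line_iff[OF xyz(2), of 0 0 1]
    unfolding xyz(1) line_at_infinity_def by simp
  show "P \<in> insert (proj_point 0 1 0) (range (\<lambda>c. proj_point 1 c 0))"
  proof (cases "x = 0")
    case True
    then have "P = proj_point 0 1 0"
      using xyz z proj_point_scale[of y 0 1 0] by simp
    then show ?thesis by simp
  next
    case False
    then have "P = proj_point 1 (y / x) 0"
      using xyz z proj_point_scale[of x 1 "y / x" 0] by simp
    then show ?thesis by simp
  qed
qed (auto simp: line_at_infinity_def proj_point_in_proj_line_iff)

lemma inj_proj_point_slope: "inj (\<lambda>c. proj_point 1 c 0)"
proof (rule injI)
  fix c c' :: 'a
  assume e: "proj_point 1 c 0 = proj_point 1 c' 0"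
  have "proj_point 1 c 0 \<in> proj_line (- c) 1 0"
    by (simp add: proj_point_in_proj_line_iff)
  then show "c = c'"
    unfolding e by (simp add: proj_point_in_proj_line_iff)
qed

lemma vertical_ne_slope:
  fixes c :: "'a::field"
  shows "proj_point 0 1 0 \<noteq> proj_point 1 c 0"
proof
  assume e: "proj_point 0 1 0 = proj_point 1 c 0"
  have "proj_point (0::'a) 1 0 \<in> proj_line 1 0 0"
    by (simp add: proj_point_in_proj_line_iff)
  then show False
    unfolding e by (simp add: proj_point_in_proj_line_iff)
qed

lemma card_line_at_infinity:
  "card (line_at_infinity :: ('a::{field,finite} ^ 3) set set) = CARD('a) + 1"
proof -
  have "proj_point 0 1 0 \<notin> range (\<lambda>c::'a. proj_point 1 c 0)"
    using vertical_ne_slope by blast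
  then show ?thesis
    unfolding line_at_infinity_eq by (simp add: card_image inj_proj_point_slope)
qed

text \<open>The affine lines through the infinite point \<open>(x,y,0)\<close> are the lines \<open>yX - xY + cZ = 0\<close>, one for
  each field element \<open>c\<close>.\<close>

lemma card_affine_lines_through_infinite_point:
  fixes P :: "('a::{field,finite} ^ 3) set"
  assumes "P \<in> line_at_infinity"
  shows "card {l \<in> proj_lines. P \<in> l \<and> l \<noteq> line_at_infinity} = CARD('a)"
proof -
  obtain x y where P: "P = proj_point x y 0" and nz: "\<not> (x = 0 \<and> y = 0)"
    using assms unfolding line_at_infinity_eq by auto
  then have nz': "\<not> (x = 0 \<and> y = 0 \<and> (0::'a) = 0)"
    by simp
  let ?f = "\<lambda>c. proj_line y (- x) c"
  have inj: "inj ?f"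
  proof (rule injI)
    fix c c'
    assume e: "?f c = ?f c'"
    show "c = c'"
    proof (cases "x = 0")
      case True
      then have "proj_point (- c / y) 0 1 \<in> ?f c"
        using nz by (simp add: proj_point_in_proj_line_iff)
      then show ?thesis
        unfolding e using True nz by (simp add: proj_point_in_proj_line_iff)
    next
      case False
      then have "proj_point 0 (c / x) 1 \<in> ?f c"
        by (simp add: proj_point_in_proj_line_iff)
      then show ?thesis
        unfolding e using False by (simp add: proj_point_in_proj_line_iff)
    qed
  qed
  have "range ?f = {l \<in> proj_lines. P \<in> l \<and> l \<noteq> line_at_infinity}"
  proof (intro equalityI subsetI)
    fix l assume "l \<in> range ?f"
    then obtain c where l: "l = ?f c" by auto
    have "l \<in> proj_lines"
      unfolding l proj_lines_def using nz by (intro CollectI exI conjI[OF refl]) auto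
    moreover have "P \<in> l"
      unfolding l P proj_point_in_proj_line_iff[OF nz'] by simp
    moreover have "l \<noteq> line_at_infinity"
    proof
      assume l': "l = line_at_infinity"
      have "proj_point 0 1 0 \<in> l" "proj_point 1 0 0 \<in> l"
        unfolding l' line_at_infinity_def by (simp_all add: proj_point_in_proj_line_iff)
      then show False
        using nz unfolding l by (simp add: proj_point_in_proj_line_iff)
    qed
    ultimately show "l \<in> {l \<in> proj_lines. P \<in> l \<and> l \<noteq> line_at_infinity}"
      by simp
  next
    fix l assume l: "l \<in> {l \<in> proj_lines. P \<in> l \<and> l \<noteq> line_at_infinity}"
    then obtain a b c where abc: "l = proj_line a b c" "\<not> (a = 0 \<and> b = 0 \<and> c = 0)"
      unfolding proj_lines_def by auto
    have e: "a * x + b * y = 0"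
      using l proj_point_in_proj_line_iff[OF nz', of a b c] unfolding abc(1) P by simp
    have "\<not> (a = 0 \<and> b = 0)"
    proof
      assume "a = 0 \<and> b = 0"
      then have "l = line_at_infinity"
        using abc proj_line_scale[of c 0 0 1] unfolding line_at_infinity_def by simp
      then show False
        using l by simp
    qed
    then obtain k where k: "k \<noteq> 0" "a = k * y" "b = k * (- x)"
      using cross_zero_imp_proportional[of "- x" 0 0 b a y] nz e
      by (auto simp: algebra_simps add_eq_0_iff)
    then have "l = ?f (c / k)"
      using proj_line_scale[OF k(1), of y "- x" "c / k"] unfolding abc(1) by simp
    then show "l \<in> range ?f" by simp
  qed
  then show ?thesis
    using card_image[OF inj] by simp
qed

section \<open>Directions of affine point sets of size q\<close>

text \<open>The line through two points; an arbitrary line through the point if they coincide, and an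
  arbitrary set if there is no such line.\<close>

definition joining_line :: "('a::field ^ 3) set \<Rightarrow> ('a ^ 3) set \<Rightarrow> ('a ^ 3) set set" where
  "joining_line P Q = (SOME l. l \<in> proj_lines \<and> P \<in> l \<and> Q \<in> l)"

lemma join_line:
  assumes "P \<in> proj_points" "Q \<in> proj_points" "P \<noteq> Q"
  shows "joining_line P Q \<in> proj_lines" "P \<in> joining_line P Q" "Q \<in> joining_line P Q"
  using exists_joining_line[OF assms] unfolding joining_line_def by (metis (mono_tags, lifting) someI)+

lemma join_eqI:
  assumes "P \<noteq> Q" "l \<in> proj_lines" "P \<in> l" "Q \<in> l"
  shows "joining_line P Q = l"
proof -
  have "P \<in> proj_points" "Q \<in> proj_points"
    using assms line_subset_proj_points by blast+
  then show ?thesis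
    using join_line joining_line_unique assms by metis
qed

lemma minimal_blocking_setI:
  assumes "blocking_set S"
    and "\<And>P. P \<in> S \<Longrightarrow> \<exists>l\<in>proj_lines. l \<inter> S \<subseteq> {P}"
  shows "minimal_blocking_set S"
  unfolding minimal_blocking_set_def
proof (intro conjI notI)
  assume "\<exists>T. T \<subset> S \<and> blocking_set T"
  then obtain T P where T: "T \<subset> S" "blocking_set T" and P: "P \<in> S" "P \<notin> T" by blast
  obtain l where "l \<in> proj_lines" "l \<inter> S \<subseteq> {P}"
    using assms(2)[OF P(1)] by blast
  moreover have "l \<inter> T \<noteq> {}"
    using T(2) \<open>l \<in> proj_lines\<close> unfolding blocking_set_def by blast
  ultimately show False
    using T(1) P by blast
qed (fact assms(1))

context
  fixes U :: "('a::{field,finite} ^ 3) set set"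
  assumes affine: "U \<subseteq> proj_points" "U \<inter> line_at_infinity = {}"
    and card_U: "card U = CARD('a)"
begin

abbreviation (input) "D \<equiv> determined_directions U"

lemma determined_directions_subset: "D \<subseteq> line_at_infinity"
  unfolding determined_directions_def by auto

lemma join_affine_infinite:
  assumes "Q \<in> U" "P \<in> line_at_infinity"
  shows "joining_line Q P \<in> proj_lines" "Q \<in> joining_line Q P" "P \<in> joining_line Q P"
    "joining_line Q P \<noteq> line_at_infinity"
proof -
  have "Q \<in> proj_points" "P \<in> proj_points" "Q \<noteq> P"
    using assms affine line_subset_proj_points[OF line_at_infinity_in_proj_lines] by auto
  then show "joining_line Q P \<in> proj_lines" "Q \<in> joining_line Q P" "P \<in> joining_line Q P"
    by (simp_all add: join_line)
  then show "joining_line Q P \<noteq> line_at_infinity"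
    using assms affine by auto
qed

lemma join_affine_infinite_eqI:
  assumes "Q \<in> U" "P \<in> line_at_infinity" "l \<in> proj_lines" "Q \<in> l" "P \<in> l"
  shows "joining_line Q P = l"
proof (rule join_eqI)
  show "Q \<noteq> P"
    using assms(1,2) affine(2) by blast
qed (use assms in auto)

lemma not_determined_iff_inj_join:
  assumes "P \<in> line_at_infinity"
  shows "P \<notin> D \<longleftrightarrow> inj_on (\<lambda>Q. joining_line Q P) U"
proof
  assume P: "P \<notin> D"
  show "inj_on (\<lambda>Q. joining_line Q P) U"
  proof (rule inj_onI, rule ccontr)
    fix Q R assume "Q \<in> U" "R \<in> U" "joining_line Q P = joining_line R P" "Q \<noteq> R"
    then have "P \<in> D"
      using join_affine_infinite[of Q P] join_affine_infinite[of R P] assms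
      unfolding determined_directions_def by auto
    with P show False ..
  qed
next
  assume inj: "inj_on (\<lambda>Q. joining_line Q P) U"
  show "P \<notin> D"
  proof
    assume "P \<in> D"
    then obtain Q R l where "Q \<in> U" "R \<in> U" "Q \<noteq> R" "l \<in> proj_lines" "Q \<in> l" "R \<in> l" "P \<in> l"
      unfolding determined_directions_def by auto
    then show False
      using inj_onD[OF inj, of Q R] join_affine_infinite_eqI assms by auto
  qed
qed

text \<open>Both the points of \<open>U\<close> and the affine lines through \<open>P\<close> number \<open>q\<close>, so the map sending a point
  of \<open>U\<close> to its join with \<open>P\<close> is injective if and only if it is surjective.\<close>

lemma not_determined_iff_all_lines_meet:
  assumes P: "P \<in> line_at_infinity"
  shows "P \<notin> D \<longleftrightarrow> (\<forall>l\<in>proj_lines. P \<in> l \<and> l \<noteq> line_at_infinity \<longrightarrow> l \<inter> U \<noteq> {})"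
proof -
  let ?L = "{l \<in> proj_lines. P \<in> l \<and> l \<noteq> line_at_infinity}" and ?j = "\<lambda>Q. joining_line Q P"
  have sub: "?j ` U \<subseteq> ?L"
    using join_affine_infinite P by auto
  have cardL: "card ?L = card U"
    using card_affine_lines_through_infinite_point[OF P] card_U by simp
  have "inj_on ?j U \<longleftrightarrow> card (?j ` U) = card U"
    by (simp add: inj_on_iff_eq_card)
  also have "\<dots> \<longleftrightarrow> ?j ` U = ?L"
  proof
    assume "card (?j ` U) = card U"
    then show "?j ` U = ?L"
      using cardL by (intro card_subset_eq[OF finite sub]) simp
  next
    assume "?j ` U = ?L"
    then show "card (?j ` U) = card U"
      using cardL by simp
  qed
  also have "\<dots> \<longleftrightarrow> (\<forall>l\<in>?L. l \<inter> U \<noteq> {})"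
  proof
    assume e: "?j ` U = ?L"
    show "\<forall>l\<in>?L. l \<inter> U \<noteq> {}"
    proof
      fix l assume "l \<in> ?L"
      then obtain Q where "Q \<in> U" "l = ?j Q"
        unfolding e[symmetric] by auto
      then show "l \<inter> U \<noteq> {}"
        using join_affine_infinite P by auto
    qed
  next
    assume m: "\<forall>l\<in>?L. l \<inter> U \<noteq> {}"
    have "?L \<subseteq> ?j ` U"
    proof
      fix l assume l: "l \<in> ?L"
      then obtain Q where "Q \<in> U" "Q \<in> l" using m by blast
      then show "l \<in> ?j ` U"
        using l P join_affine_infinite_eqI[of Q P l] by auto
    qed
    with sub show "?j ` U = ?L" by simp
  qed
  finally show ?thesis
    using not_determined_iff_inj_join[OF P] by auto
qed

text \<open>If \<open>U\<close> were contained in an affine line, all of its secants would be that line, which meets the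
  line at infinity only once.\<close>

lemma exists_point_off_affine_line:
  assumes "card D \<ge> 2" "l \<in> proj_lines" "l \<noteq> line_at_infinity"
  shows "\<exists>Q\<in>U. Q \<notin> l"
proof (rule ccontr)
  assume "\<not> (\<exists>Q\<in>U. Q \<notin> l)"
  then have U: "U \<subseteq> l" by blast
  have "P \<in> l" if P: "P \<in> D" for P
  proof -
    obtain Q R m where m: "Q \<in> U" "R \<in> U" "Q \<noteq> R" "m \<in> proj_lines" "Q \<in> m" "R \<in> m" "P \<in> m"
      using P unfolding determined_directions_def by auto
    then have "m = l"
      using joining_line_unique[of m l Q R] assms(2) U by blast
    then show ?thesis using m by simp
  qed
  moreover obtain P P' where P: "P \<in> D" "P' \<in> D" "P \<noteq> P'"
  proof -
    have "\<not> card D \<le> Suc 0"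
      using assms(1) by simp
    then show thesis
      using that card_le_Suc0_iff_eq[of D] by auto
  qed
  ultimately show False
    using joining_line_unique[of l line_at_infinity P P'] assms line_at_infinity_in_proj_lines
      determined_directions_subset by blast
qed

text \<open>The joins of a point of \<open>U\<close> off an affine line \<open>l\<close> with the points of \<open>U\<close> on \<open>l\<close> determine
  distinct directions, none of which lies on \<open>l\<close>.\<close>

lemma card_line_inter_le_card_directions:
  assumes two: "card D \<ge> 2" and l: "l \<in> proj_lines"
  shows "card (l \<inter> (U \<union> D)) \<le> card D"
proof (cases "l = line_at_infinity")
  case True
  then have "l \<inter> (U \<union> D) = D"
    using affine determined_directions_subset by blast
  then show ?thesis by simp
next
  case False
  obtain P where P: "P \<in> l" "P \<in> line_at_infinity"
    using lines_meet_in_unique_point[OF l line_at_infinity_in_proj_lines False] by blast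
  have Puniq: "X = P" if "X \<in> l" "X \<in> line_at_infinity" for X
    using lines_meet_in_unique_point[OF l line_at_infinity_in_proj_lines False] P that by blast
  obtain Q where Q: "Q \<in> U" "Q \<notin> l"
    using exists_point_off_affine_line[OF two l False] by blast
  have "\<exists>X\<in>D - {P}. \<exists>m\<in>proj_lines. Q \<in> m \<and> R \<in> m \<and> X \<in> m" if R: "R \<in> l \<inter> U" for R
  proof -
    have QR: "Q \<noteq> R" using Q R by blast
    obtain m where m: "m \<in> proj_lines" "Q \<in> m" "R \<in> m"
      using exists_joining_line[of Q R] Q R affine QR by blast
    have "m \<noteq> line_at_infinity" using m Q affine by blast
    then obtain X where X: "X \<in> m" "X \<in> line_at_infinity"
      using lines_meet_in_unique_point[OF m(1) line_at_infinity_in_proj_lines] by blast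
    then have "X \<in> D"
      using m Q R QR unfolding determined_directions_def by blast
    moreover have "X \<noteq> P"
    proof
      assume "X = P"
      moreover have "P \<noteq> R" using P R affine by blast
      ultimately have "m = l"
        using joining_line_unique[of m l P R] m l X P R by blast
      then show False using m Q by simp
    qed
    ultimately show ?thesis using m X by blast
  qed
  then obtain f where f: "\<And>R. R \<in> l \<inter> U \<Longrightarrow> f R \<in> D - {P} \<and>
      (\<exists>m\<in>proj_lines. Q \<in> m \<and> R \<in> m \<and> f R \<in> m)"
    by metis
  have "inj_on f (l \<inter> U)"
  proof (rule inj_onI, rule ccontr)
    fix R R' assume R: "R \<in> l \<inter> U" "R' \<in> l \<inter> U" "f R = f R'" "R \<noteq> R'"
    obtain m where m: "m \<in> proj_lines" "Q \<in> m" "R \<in> m" "f R \<in> m"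
      using f[OF R(1)] by blast
    obtain m' where m': "m' \<in> proj_lines" "Q \<in> m'" "R' \<in> m'" "f R' \<in> m'"
      using f[OF R(2)] by blast
    have "f R \<noteq> Q"
      using f[OF R(1)] Q affine determined_directions_subset by blast
    then have "m = m'"
      using joining_line_unique[of m m' "f R" Q] m m' R by simp
    then have "m = l"
      using joining_line_unique[of m l R R'] m m' l R by blast
    then show False using m Q by simp
  qed
  then have le: "card (l \<inter> U) \<le> card (D - {P})"
    using f by (intro card_inj_on_le[of f]) auto
  have "l \<inter> (U \<union> D) \<subseteq> l \<inter> U \<union> D \<inter> {P}"
    using Puniq determined_directions_subset by blast
  then have "card (l \<inter> (U \<union> D)) \<le> card (l \<inter> U \<union> D \<inter> {P})"
    by (intro card_mono) auto
  also have "\<dots> \<le> card (l \<inter> U) + card (D \<inter> {P})"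
    by (rule card_Un_le)
  also have "\<dots> \<le> card (D - {P}) + card (D \<inter> {P})"
    using le by simp
  also have "\<dots> = card D"
    using card_Int_Diff[of D "{P}"] by simp
  finally show ?thesis .
qed

lemma card_union_directions: "card (U \<union> D) = CARD('a) + card D"
proof -
  have "U \<inter> D = {}"
    using affine determined_directions_subset by blast
  then show ?thesis
    using card_U by (simp add: card_Un_disjoint)
qed

lemma minimal_blocking_set_union_directions:
  assumes two: "card D \<ge> 2" and N: "N \<in> line_at_infinity" "N \<notin> D"
  shows "minimal_blocking_set (U \<union> D)"
proof (rule minimal_blocking_setI)
  have meet: "l \<inter> (U \<union> D) \<noteq> {}" if l: "l \<in> proj_lines" for l
  proof (cases "l = line_at_infinity")
    case True
    have "D \<noteq> {}" using two by auto
    then show ?thesis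
      using determined_directions_subset True by blast
  next
    case False
    then obtain P where "P \<in> l" "P \<in> line_at_infinity"
      using lines_meet_in_unique_point[OF l line_at_infinity_in_proj_lines] by blast
    then show ?thesis
      using not_determined_iff_all_lines_meet[of P] l False by blast
  qed
  have not_sub: "\<not> l \<subseteq> U \<union> D" if l: "l \<in> proj_lines" for l
  proof
    assume sub: "l \<subseteq> U \<union> D"
    have False: "l \<noteq> line_at_infinity"
      using sub N affine by blast
    obtain Q where Q: "Q \<in> U" "Q \<notin> l"
      using exists_point_off_affine_line[OF two l False] by blast
    note j = join_affine_infinite[OF Q(1) N(1)]
    \<comment> \<open>The line through Q in the direction N meets l in a point R of U, so N is determined.\<close>
    obtain R where R: "R \<in> l" "R \<in> joining_line Q N"
      using lines_meet_in_unique_point[OF l j(1)] j(2) Q(2) by blast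
    have "R \<notin> D"
    proof
      assume "R \<in> D"
      moreover from this have "R = N"
        using lines_meet_in_unique_point[OF j(1) line_at_infinity_in_proj_lines j(4)] j(3) R N
          determined_directions_subset by blast
      ultimately show False using N by blast
    qed
    then have "R \<in> U" using R sub by blast
    moreover have "R \<noteq> Q" using R Q by blast
    ultimately have "N \<in> D"
      unfolding determined_directions_def using j Q R N by blast
    then show False using N by simp
  qed
  have "U \<union> D \<subseteq> proj_points"
    using affine determined_directions_subset
      line_subset_proj_points[OF line_at_infinity_in_proj_lines] by blast
  then show "blocking_set (U \<union> D)"
    using meet not_sub unfolding blocking_set_def by blast
  fix P assume "P \<in> U \<union> D"
  then show "\<exists>l\<in>proj_lines. l \<inter> (U \<union> D) \<subseteq> {P}"
  proof
    assume P: "P \<in> U"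
    note j = join_affine_infinite[OF P N(1)]
    have "X = P" if X: "X \<in> joining_line P N" "X \<in> U \<union> D" for X
    proof (rule ccontr)
      assume ne: "X \<noteq> P"
      show False
      proof (cases "X \<in> U")
        case True
        then have "N \<in> D"
          unfolding determined_directions_def using j P X N ne by blast
        then show False using N by simp
      next
        case False
        then have "X \<in> D" using X by simp
        moreover from this have "X = N"
          using lines_meet_in_unique_point[OF j(1) line_at_infinity_in_proj_lines j(4)] j(3) X N
            determined_directions_subset by blast
        ultimately show False using N by simp
      qed
    qed
    then show ?thesis using j(1) by blast
  next
    assume P: "P \<in> D"
    then have Pi: "P \<in> line_at_infinity"
      using determined_directions_subset by blast
    obtain l where l: "l \<in> proj_lines" "P \<in> l" "l \<noteq> line_at_infinity" "l \<inter> U = {}"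
      using not_determined_iff_all_lines_meet[OF Pi] P by blast
    have "l \<inter> D \<subseteq> {P}"
      using lines_meet_in_unique_point[OF l(1) line_at_infinity_in_proj_lines l(3)] l(2) Pi
        determined_directions_subset by blast
    then show ?thesis using l by blast
  qed
qed

theorem redei_blocking_set_union_directions:
  assumes "card D \<ge> 2" "D \<noteq> line_at_infinity"
  shows "redei_blocking_set (U \<union> D)"
proof -
  obtain N where N: "N \<in> line_at_infinity" "N \<notin> D"
    using assms(2) determined_directions_subset by blast
  have inf: "(U \<union> D) \<inter> line_at_infinity = D"
    using affine determined_directions_subset by blast
  have "Max ((\<lambda>l. card ((U \<union> D) \<inter> l)) ` proj_lines) = card D"
  proof (rule Max_eqI)
    show "card D \<in> (\<lambda>l. card ((U \<union> D) \<inter> l)) ` proj_lines"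
      using inf line_at_infinity_in_proj_lines by (metis (no_types, lifting) imageI)
  next
    fix n assume "n \<in> (\<lambda>l. card ((U \<union> D) \<inter> l)) ` proj_lines"
    then show "n \<le> card D"
      using card_line_inter_le_card_directions[OF assms(1)] by (auto simp: Int_commute)
  qed simp
  then show ?thesis
    unfolding redei_blocking_set_def
    using minimal_blocking_set_union_directions[OF assms(1) N] card_union_directions by blast
qed

end

section \<open>Directions in affine coordinates\<close>

text \<open>The embedding of the affine plane in the projective plane as the complement of \<open>Z = 0\<close>.\<close>

definition affine_point :: "'a::field \<times> 'a \<Rightarrow> ('a ^ 3) set" where
  "affine_point p = proj_point (fst p) (snd p) 1"

lemma inj_affine_point: "inj affine_point"
proof (rule injI)
  fix p p' :: "'a \<times> 'a"
  assume e: "affine_point p = affine_point p'"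
  have "affine_point p \<in> proj_line 1 0 (- fst p)" "affine_point p \<in> proj_line 0 1 (- snd p)"
    unfolding affine_point_def by (simp_all add: proj_point_in_proj_line_iff)
  then show "p = p'"
    unfolding e unfolding affine_point_def
    by (simp add: proj_point_in_proj_line_iff prod_eq_iff)
qed

lemma direction_determined_iff:
  assumes nz: "\<not> (u = 0 \<and> v = 0)"
  shows "proj_point u v 0 \<in> determined_directions (affine_point ` V) \<longleftrightarrow>
    (\<exists>(x, y)\<in>V. \<exists>(x', y')\<in>V. (x, y) \<noteq> (x', y') \<and> u * (y' - y) = v * (x' - x))"
    (is "?l \<longleftrightarrow> ?r")
proof
  assume ?l
  then obtain x y x' y' l where V: "(x, y) \<in> V" "(x', y') \<in> V"
      "affine_point (x, y) \<noteq> affine_point (x', y')"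
    and l: "l \<in> proj_lines" "affine_point (x, y) \<in> l" "affine_point (x', y') \<in> l"
      "proj_point u v 0 \<in> l"
    unfolding determined_directions_def by (auto; blast)
  obtain a b c where abc: "l = proj_line a b c" "\<not> (a = 0 \<and> b = 0 \<and> c = 0)"
    using l(1) unfolding proj_lines_def by auto
  have e: "a * x + b * y + c = 0" "a * x' + b * y' + c = 0" "a * u + b * v = 0"
    using l nz unfolding abc(1) affine_point_def by (auto simp: proj_point_in_proj_line_iff)
  then have "\<not> (a = 0 \<and> b = 0)"
    using abc(2) by auto
  moreover have "a * (u * (y' - y) - v * (x' - x)) = 0" "b * (u * (y' - y) - v * (x' - x)) = 0"
    using e by algebra+
  ultimately have "u * (y' - y) = v * (x' - x)"
    by auto
  then show ?r
    using V by (intro bexI[of _ "(x, y)"] bexI[of _ "(x', y')"]) auto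
next
  assume ?r
  then obtain x y x' y' where V: "(x, y) \<in> V" "(x', y') \<in> V" "(x, y) \<noteq> (x', y')"
    and e: "u * (y' - y) = v * (x' - x)" by blast
  let ?m = "proj_line (y' - y) (x - x') (y * x' - x * y')"
  have "?m \<in> proj_lines"
    unfolding proj_lines_def using V(3) by (intro CollectI exI conjI[OF refl]) auto
  moreover have "affine_point (x, y) \<in> ?m" "affine_point (x', y') \<in> ?m" "proj_point u v 0 \<in> ?m"
    using nz e unfolding affine_point_def
    by (auto simp: proj_point_in_proj_line_iff algebra_simps)
  moreover have "affine_point (x, y) \<noteq> affine_point (x', y')"
    using V(3) inj_affine_point by (auto dest: injD)
  moreover have "proj_point u v 0 \<in> line_at_infinity"
    using nz unfolding line_at_infinity_def by (simp add: proj_point_in_proj_line_iff)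
  ultimately show ?l
    unfolding determined_directions_def using V by blast
qed

text \<open>The case of a set of affine points that determines the vertical direction and exactly the slopes
  outside a nonempty proper subset \<open>C\<close> of the field.\<close>

lemma redei_blocking_set_of_slopes:
  fixes V :: "('a::{field,finite} \<times> 'a) set"
  defines "U \<equiv> affine_point ` V"
  assumes card_V: "card V = CARD('a)" and C: "card C = d" "0 < d" "d < CARD('a)"
    and vertical: "(0, y) \<in> V" "(0, y') \<in> V" "y \<noteq> y'"
    and slopes: "\<And>c. c \<notin> C \<longleftrightarrow>
      (\<exists>(x, y)\<in>V. \<exists>(x', y')\<in>V. (x, y) \<noteq> (x', y') \<and> y' - y = c * (x' - x))"
  shows "determined_directions U = line_at_infinity - (\<lambda>c. proj_point 1 c 0) ` C"
    and "card (determined_directions U) = CARD('a) + 1 - d"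
    and "redei_blocking_set (U \<union> determined_directions U)"
    and "card (U \<union> determined_directions U) = 2 * CARD('a) + 1 - d"
proof -
  let ?D = "determined_directions U" and ?W = "(\<lambda>c. proj_point 1 c 0) ` C"
  have card_U: "card U = CARD('a)"
    unfolding U_def using card_V by (simp add: card_image inj_on_subset[OF inj_affine_point])
  have affine: "U \<subseteq> proj_points" "U \<inter> line_at_infinity = {}"
    unfolding U_def affine_point_def line_at_infinity_def
    by (auto simp: proj_point_in_proj_line_iff intro: proj_point_in_proj_points)
  have v: "proj_point 0 1 0 \<in> ?D"
    unfolding U_def using vertical by (subst direction_determined_iff) force+
  have s: "proj_point 1 c 0 \<in> ?D \<longleftrightarrow> c \<notin> C" for c
    unfolding U_def slopes by (subst direction_determined_iff) auto
  show D: "?D = line_at_infinity - ?W"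
  proof (intro equalityI subsetI)
    fix P assume P: "P \<in> ?D"
    then have "P \<in> line_at_infinity"
      unfolding determined_directions_def by simp
    then show "P \<in> line_at_infinity - ?W"
      using P s by auto
  next
    fix P assume "P \<in> line_at_infinity - ?W"
    then show "P \<in> ?D"
      using v s unfolding line_at_infinity_eq by auto
  qed
  have "card ?W = d"
    using C(1) by (simp add: card_image inj_on_subset[OF inj_proj_point_slope])
  moreover have W: "?W \<subseteq> line_at_infinity"
    unfolding line_at_infinity_eq by blast
  ultimately show card_D: "card ?D = CARD('a) + 1 - d"
    unfolding D using card_line_at_infinity[where 'a='a] by (simp add: card_Diff_subset)
  then show "card (U \<union> ?D) = 2 * CARD('a) + 1 - d"
    using card_union_directions[OF affine card_U] C(3) by simp
  have "card ?D \<noteq> card (line_at_infinity :: ('a ^ 3) set set)"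
    using card_D card_line_at_infinity[where 'a='a] C(2,3) by simp
  then show "redei_blocking_set (U \<union> ?D)"
    using redei_blocking_set_union_directions[OF affine card_U] card_D C(3) by fastforce
qed

section \<open>Cosets in the multiplicative and the additive group\<close>

lemma group_field_mult_group: "group field_mult_group"
proof (rule groupI)
  fix x :: 'a
  assume "x \<in> carrier field_mult_group"
  then show "\<exists>y\<in>carrier field_mult_group. y \<otimes>\<^bsub>field_mult_group\<^esub> x = \<one>\<^bsub>field_mult_group\<^esub>"
    by (intro bexI[of _ "inverse x"]) (auto simp: field_mult_group_def)
qed (auto simp: field_mult_group_def)

lemma group_field_add_group: "group field_add_group"
proof (rule groupI)
  fix x :: 'a
  assume "x \<in> carrier field_add_group"
  then show "\<exists>y\<in>carrier field_add_group. y \<otimes>\<^bsub>field_add_group\<^esub> x = \<one>\<^bsub>field_add_group\<^esub>"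
    by (intro bexI[of _ "- x"]) (auto simp: field_add_group_def)
qed (auto simp: field_add_group_def)

lemma subgroup_field_mult_groupD:
  assumes "subgroup H field_mult_group"
  shows "0 \<notin> H" "1 \<in> H" "\<And>x y. x \<in> H \<Longrightarrow> y \<in> H \<Longrightarrow> x * y \<in> H"
    "\<And>x. x \<in> H \<Longrightarrow> inverse x \<in> H"
proof -
  show "0 \<notin> H" using subgroup.subset[OF assms] by (auto simp: field_mult_group_def)
  show "1 \<in> H" using subgroup.one_closed[OF assms] by (simp add: field_mult_group_def)
  show "x * y \<in> H" if "x \<in> H" "y \<in> H" for x y
    using subgroup.m_closed[OF assms] that by (simp add: field_mult_group_def)
  show "inverse x \<in> H" if x: "x \<in> H" for x
  proof -
    have "x \<noteq> 0" using x \<open>0 \<notin> H\<close> by auto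
    then have "inv\<^bsub>field_mult_group\<^esub> x = inverse x"
      by (intro group.inv_equality group_field_mult_group) (auto simp: field_mult_group_def)
    then show ?thesis using group.subgroupE(3)[OF group_field_mult_group assms x] by simp
  qed
qed

lemma subgroup_field_add_groupD:
  assumes "subgroup H field_add_group"
  shows "0 \<in> H" "\<And>x y. x \<in> H \<Longrightarrow> y \<in> H \<Longrightarrow> x + y \<in> H" "\<And>x. x \<in> H \<Longrightarrow> - x \<in> H"
proof -
  show "0 \<in> H" using subgroup.one_closed[OF assms] by (simp add: field_add_group_def)
  show "x + y \<in> H" if "x \<in> H" "y \<in> H" for x y
    using subgroup.m_closed[OF assms] that by (simp add: field_add_group_def)
  show "- x \<in> H" if x: "x \<in> H" for x
  proof -
    have "inv\<^bsub>field_add_group\<^esub> x = - x"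
      by (intro group.inv_equality group_field_add_group) (auto simp: field_add_group_def)
    then show ?thesis using group.subgroupE(3)[OF group_field_add_group assms x] by simp
  qed
qed

lemma l_coset_field_mult_group: "g <#\<^bsub>field_mult_group\<^esub> H = (*) g ` H"
  by (auto simp: l_coset_def field_mult_group_def)

lemma l_coset_field_add_group: "g <#\<^bsub>field_add_group\<^esub> H = (+) g ` H"
  by (auto simp: l_coset_def field_add_group_def)

text \<open>Both constructions remove the points of a coset \<open>A\<close> from the line \<open>X = 0\<close> and add equally many
  affine points off that line, indexed by another coset \<open>B\<close>.\<close>

lemma card_axis_union:
  fixes A B :: "'a::{finite,zero} set" and f :: "'a \<Rightarrow> 'a \<times> 'a"
  assumes "card A = card B" "inj_on f B" "\<And>b. b \<in> B \<Longrightarrow> fst (f b) \<noteq> 0"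
  shows "card ((\<lambda>h. (0, h)) ` (- A) \<union> f ` B) = CARD('a)"
proof -
  have "(\<lambda>h. (0, h)) ` (- A) \<inter> f ` B = {}"
    using assms(3) by auto (metis fst_conv)
  then have "card ((\<lambda>h. (0, h)) ` (- A) \<union> f ` B) = card (- A) + card B"
    using assms(2) by (simp add: card_Un_disjoint card_image inj_on_def)
  also have "\<dots> = CARD('a)"
    using assms(1) by (simp add: Compl_eq_Diff_UNIV card_Diff_subset card_mono)
  finally show ?thesis .
qed

lemma two_points_outside:
  fixes A :: "'a::finite set"
  assumes "card A + 2 \<le> CARD('a)"
  obtains y y' where "y \<notin> A" "y' \<notin> A" "y \<noteq> y'"
proof -
  have "\<not> card (- A) \<le> Suc 0"
    using assms by (simp add: Compl_eq_Diff_UNIV card_Diff_subset)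
  then show thesis
    using that card_le_Suc0_iff_eq[of "- A"] by auto
qed

section \<open>The two constructions\<close>

text \<open>The line through \<open>(0,h)\<close> and \<open>(-g,0)\<close> has slope \<open>h / g\<close>. So a nonzero slope \<open>c\<close> is not
  determined if and only if \<open>c * g\<close> lies in \<open>g0 H\<close> for all \<open>g\<close> in \<open>g1 H\<close>; slope zero is determined by
  the origin and any point \<open>(-g,0)\<close>.\<close>

lemma multiplicative_construction:
  fixes H :: "'a::{field,finite} set" and g0 g1 :: 'a
  assumes d: "card H < CARD('a) - 1" and H: "subgroup H field_mult_group"
    and g: "g0 \<noteq> 0" "g1 \<noteq> 0"
  defines "U \<equiv> {proj_point 0 h 1 | h. h \<notin> (*) g0 ` H} \<union> {proj_point (- g) 0 1 | g. g \<in> (*) g1 ` H}"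
  shows "determined_directions U = line_at_infinity - (\<lambda>c. proj_point 1 c 0) ` (*) (g0 / g1) ` H"
    and "card (determined_directions U) = CARD('a) + 1 - card H"
    and "redei_blocking_set (U \<union> determined_directions U)"
    and "card (U \<union> determined_directions U) = 2 * CARD('a) + 1 - card H"
proof -
  note Hs = subgroup_field_mult_groupD[OF H]
  let ?A = "(*) g0 ` H" and ?B = "(*) g1 ` H" and ?C = "(*) (g0 / g1) ` H"
  define V where "V = (\<lambda>h. (0::'a, h)) ` (- ?A) \<union> (\<lambda>g. (- g, 0)) ` ?B"
  have "(x, y) \<in> (\<lambda>g. (- g, 0)) ` S \<longleftrightarrow> y = 0 \<and> - x \<in> S" for x y and S :: "'a set"
    by (force simp: image_iff)
  then have mem_V: "(x, y) \<in> V \<longleftrightarrow> x = 0 \<and> y \<notin> ?A \<or> y = 0 \<and> - x \<in> ?B" for x y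
    unfolding V_def by (simp only: Un_iff) blast
  have card: "card ((*) k ` H) = card H" if "k \<noteq> 0" for k
    using that by (intro card_image) (auto simp: inj_on_def)
  have U: "U = affine_point ` V"
    unfolding U_def V_def affine_point_def by (auto simp: image_Un image_image)
  have cV: "card V = CARD('a)"
    unfolding V_def by (rule card_axis_union) (use g Hs(1) in \<open>auto simp: card inj_on_def\<close>)
  have cC: "card ?C = card H" using g by (intro card) simp
  have pos: "0 < card H" using Hs(2) by (auto simp: card_gt_0_iff)
  have "card ?A + 2 \<le> CARD('a)"
    using card[OF g(1)] d by linarith
  then obtain y y' where y: "y \<notin> ?A" "y' \<notin> ?A" "y \<noteq> y'"
    by (rule two_points_outside)
  then have y2: "(0, y) \<in> V" "(0, y') \<in> V" by (simp_all add: mem_V)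
  have mixed: "c * g \<in> ?A" if cg: "c \<in> ?C" "g \<in> ?B" for c g
  proof -
    obtain k h where "k \<in> H" "h \<in> H" "c = g0 / g1 * k" "g = g1 * h"
      using cg by blast
    then show ?thesis
      using g Hs(3)[of k h] by (auto intro: image_eqI[of _ _ "k * h"])
  qed
  have slopes: "c \<notin> ?C \<longleftrightarrow>
      (\<exists>(x, y)\<in>V. \<exists>(x', y')\<in>V. (x, y) \<noteq> (x', y') \<and> y' - y = c * (x' - x))" for c
  proof
    assume c: "c \<notin> ?C"
    have "c * g1 \<notin> ?A"
    proof
      assume "c * g1 \<in> ?A"
      then obtain h where h: "h \<in> H" "c * g1 = g0 * h" by auto
      then have "c = g0 / g1 * h" using g by (simp add: field_simps)
      then show False using c h(1) by blast
    qed
    then have "(0, c * g1) \<in> V" "(- g1, 0) \<in> V"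
      using image_eqI[of g1 "(*) g1" 1 H] Hs(2) by (simp_all add: mem_V)
    moreover have "(0, c * g1) \<noteq> (- g1, 0)" "0 - c * g1 = c * (- g1 - 0)"
      using g by auto
    ultimately show "\<exists>(x, y)\<in>V. \<exists>(x', y')\<in>V. (x, y) \<noteq> (x', y') \<and> y' - y = c * (x' - x)"
      by blast
  next
    assume r: "\<exists>(x, y)\<in>V. \<exists>(x', y')\<in>V. (x, y) \<noteq> (x', y') \<and> y' - y = c * (x' - x)"
    show "c \<notin> ?C"
    proof
      assume c: "c \<in> ?C"
      then have c0: "c \<noteq> 0" using g Hs(1) by auto
      obtain x y x' y' where V: "(x, y) \<in> V" "(x', y') \<in> V" "(x, y) \<noteq> (x', y')"
        and e: "y' - y = c * (x' - x)" using r by blast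
      from V(1,2) consider "x = 0" "x' = 0"
        | "y = 0" "y' = 0"
        | "x = 0" "y \<notin> ?A" "- x' \<in> ?B" "y' = 0"
        | "x' = 0" "y' \<notin> ?A" "- x \<in> ?B" "y = 0"
        unfolding mem_V by blast
      then show False
      proof cases
        case 1
        then show False using V(3) e by simp
      next
        case 2
        then show False using V(3) e c0 by simp
      next
        case 3
        then have "y = c * - x'" using e by (simp add: minus_equation_iff[of y] eq_commute[of y])
        then show False using 3 mixed[OF c, of "- x'"] by blast
      next
        case 4
        then have "y' = c * - x" using e by simp
        then show False using 4 mixed[OF c, of "- x"] by blast
      qed
    qed
  qed
  have d': "card H < CARD('a)" using d by simp
  note res = redei_blocking_set_of_slopes[OF cV cC pos d' y2 y(3) slopes, folded U]
  show "determined_directions U = line_at_infinity - (\<lambda>c. proj_point 1 c 0) ` ?C"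
    and "card (determined_directions U) = CARD('a) + 1 - card H"
    and "redei_blocking_set (U \<union> determined_directions U)"
    and "card (U \<union> determined_directions U) = 2 * CARD('a) + 1 - card H"
    by (fact res)+
qed

text \<open>The coset \<open>C\<close> of excluded slopes is \<open>b0 - a0 + H\<close>: a slope \<open>c\<close> is not determined if and only if
  \<open>b - c\<close> lies in \<open>a0 + H\<close> for all \<open>b\<close> in \<open>b0 + H\<close>.\<close>

lemma additive_construction:
  fixes H :: "'a::{field,finite} set" and a0 b0 :: 'a
  assumes d: "card H + 2 \<le> CARD('a)" and H: "subgroup H field_add_group"
  defines "U \<equiv> {proj_point 0 a 1 | a. a \<notin> (+) a0 ` H} \<union> {proj_point 1 b 1 | b. b \<in> (+) b0 ` H}"
  shows "redei_blocking_set (U \<union> determined_directions U)"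
    and "card (U \<union> determined_directions U) = 2 * CARD('a) + 1 - card H"
proof -
  note Hs = subgroup_field_add_groupD[OF H]
  \<comment> \<open>The slope of the line through (0,a) and (1,b) is b - a.\<close>
  let ?A = "(+) a0 ` H" and ?B = "(+) b0 ` H" and ?C = "(+) (b0 - a0) ` H"
  define V where "V = (\<lambda>h. (0::'a, h)) ` (- ?A) \<union> (\<lambda>b. (1::'a, b)) ` ?B"
  have card: "card ((+) k ` H) = card H" for k
    by (intro card_image) (auto simp: inj_on_def)
  have U: "U = affine_point ` V"
    unfolding U_def V_def affine_point_def by (auto simp: image_Un image_image)
  have cV: "card V = CARD('a)"
    unfolding V_def by (rule card_axis_union) (auto simp: card inj_on_def)
  have pos: "0 < card H" using Hs(1) by (auto simp: card_gt_0_iff)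
  have "card ?A + 2 \<le> CARD('a)"
    using card[of a0] d by simp
  then obtain y y' where y: "y \<notin> ?A" "y' \<notin> ?A" "y \<noteq> y'"
    by (rule two_points_outside)
  then have y2: "(0, y) \<in> V" "(0, y') \<in> V" by (auto simp: V_def)
  have mixed: "b - c \<in> ?A" if cb: "c \<in> ?C" "b \<in> ?B" for c b
  proof -
    obtain k h where "k \<in> H" "h \<in> H" "c = b0 - a0 + k" "b = b0 + h"
      using cb by blast
    then show ?thesis
      using Hs(2)[of h "- k"] Hs(3)[of k] by (auto intro: image_eqI[of _ _ "h + - k"])
  qed
  have slopes: "c \<notin> ?C \<longleftrightarrow>
      (\<exists>(x, y)\<in>V. \<exists>(x', y')\<in>V. (x, y) \<noteq> (x', y') \<and> y' - y = c * (x' - x))" for c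
  proof
    assume c: "c \<notin> ?C"
    have "b0 - c \<notin> ?A"
    proof
      assume "b0 - c \<in> ?A"
      then obtain h where h: "h \<in> H" "b0 - c = a0 + h" by auto
      then have "c = b0 - a0 + - h" by (simp add: algebra_simps)
      then show False using c Hs(3)[OF h(1)] by blast
    qed
    then have "(0, b0 - c) \<in> V" "(1, b0) \<in> V"
      using Hs(1) by (force simp: V_def)+
    moreover have "(0::'a, b0 - c) \<noteq> (1, b0)" "b0 - (b0 - c) = c * (1 - 0)"
      by auto
    ultimately show "\<exists>(x, y)\<in>V. \<exists>(x', y')\<in>V. (x, y) \<noteq> (x', y') \<and> y' - y = c * (x' - x)"
      by blast
  next
    assume r: "\<exists>(x, y)\<in>V. \<exists>(x', y')\<in>V. (x, y) \<noteq> (x', y') \<and> y' - y = c * (x' - x)"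
    show "c \<notin> ?C"
    proof
      assume c: "c \<in> ?C"
      obtain x y x' y' where V: "(x, y) \<in> V" "(x', y') \<in> V" "(x, y) \<noteq> (x', y')"
        and e: "y' - y = c * (x' - x)" using r by blast
      from V(1,2) consider "x = x'"
        | "x = 0" "y \<notin> ?A" "x' = 1" "y' \<in> ?B"
        | "x' = 0" "y' \<notin> ?A" "x = 1" "y \<in> ?B"
        unfolding V_def by auto
      then show False
      proof cases
        case 1
        then show False using V(3) e by simp
      next
        case 2
        then have "y = y' - c" using e by (simp add: algebra_simps)
        then show False using 2 mixed[OF c, of y'] by blast
      next
        case 3
        then have "y' = y - c" using e by (simp add: algebra_simps)
        then show False using 3 mixed[OF c, of y] by blast
      qed
    qed
  qed
  have d': "card H < CARD('a)" using d by simp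
  note res = redei_blocking_set_of_slopes[OF cV card pos d' y2 y(3) slopes, folded U]
  show "redei_blocking_set (U \<union> determined_directions U)"
    and "card (U \<union> determined_directions U) = 2 * CARD('a) + 1 - card H"
    by (fact res)+
qed

lemma proper_divisor_add_2_le:
  fixes d q :: nat
  assumes "q > 2" "d dvd q" "d < q"
  shows "d + 2 \<le> q"
proof (rule ccontr)
  assume "\<not> d + 2 \<le> q"
  then have "q = d + 1" using assms(3) by simp
  then have "d = 1" using assms(2) dvd_add_right_iff[of d d 1] by simp
  then show False using \<open>q = d + 1\<close> assms(1) by simp
qed

theorem theorem4p2:
  fixes q :: nat
  assumes q: "q = CARD('a::{field,finite})"
  shows
    "(\<forall>(d::nat) (H::'a set) g0 g1 A B1 C U W.
        d dvd q - 1 \<and> d < q - 1 \<and>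
        subgroup H field_mult_group \<and> card H = d \<and>
        g0 \<in> carrier field_mult_group \<and> g1 \<in> carrier field_mult_group \<and>
        A = g0 <#\<^bsub>field_mult_group\<^esub> H \<and>
        B1 = g1 <#\<^bsub>field_mult_group\<^esub> H \<and>
        C = (g0 / g1) <#\<^bsub>field_mult_group\<^esub> H \<and>
        U = {proj_point 0 h 1 | h. h \<notin> A} \<union> {proj_point (- g) 0 1 | g. g \<in> B1} \<and>
        W = {proj_point 1 c 0 | c. c \<in> C}
        \<longrightarrow>
        card (determined_directions U) = q + 1 - d \<and>
        determined_directions U = line_at_infinity - W \<and>
        redei_blocking_set (U \<union> determined_directions U) \<and>
        card (U \<union> determined_directions U) = 2 * q + 1 - d)
     \<and>
     (\<forall>(d::nat) (H::'a set) a0 b0 A B1 U.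
        q > 2 \<and> d dvd q \<and> d < q \<and>
        subgroup H field_add_group \<and> card H = d \<and>
        A = a0 <#\<^bsub>field_add_group\<^esub> H \<and>
        B1 = b0 <#\<^bsub>field_add_group\<^esub> H \<and>
        U = {proj_point 0 a 1 | a. a \<notin> A} \<union> {proj_point 1 b 1 | b. b \<in> B1}
        \<longrightarrow>
        redei_blocking_set (U \<union> determined_directions U) \<and>
        card (U \<union> determined_directions U) = 2 * q + 1 - d)"
proof (intro conjI allI impI; elim conjE)
  fix d :: nat and H :: "'a set" and g0 g1 :: 'a and A B1 C U W
  assume d: "d < q - 1" "card H = d" and H: "subgroup H field_mult_group"
    and g: "g0 \<in> carrier field_mult_group" "g1 \<in> carrier field_mult_group"
    and A: "A = g0 <#\<^bsub>field_mult_group\<^esub> H" and B1: "B1 = g1 <#\<^bsub>field_mult_group\<^esub> H"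
    and C: "C = (g0 / g1) <#\<^bsub>field_mult_group\<^esub> H"
    and U: "U = {proj_point 0 h 1 | h. h \<notin> A} \<union> {proj_point (- g) 0 1 | g. g \<in> B1}"
    and W: "W = {proj_point 1 c 0 | c. c \<in> C}"
  have g': "g0 \<noteq> 0" "g1 \<noteq> 0"
    using g by (auto simp: field_mult_group_def)
  have W': "W = (\<lambda>c. proj_point 1 c 0) ` (*) (g0 / g1) ` H"
    unfolding W C l_coset_field_mult_group by auto
  have lt: "card H < CARD('a) - 1" using d q by simp
  note res = multiplicative_construction[OF lt H g',
      folded l_coset_field_mult_group[of g0] l_coset_field_mult_group[of g1],
      folded A B1, folded U W', unfolded d(2), folded q]
  show "card (determined_directions U) = q + 1 - d"
    and "determined_directions U = line_at_infinity - W"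
    and "redei_blocking_set (U \<union> determined_directions U)"
    and "card (U \<union> determined_directions U) = 2 * q + 1 - d"
    by (fact res)+
next
  fix d :: nat and H :: "'a set" and a0 b0 :: 'a and A B1 U
  assume d: "q > 2" "d dvd q" "d < q" "card H = d" and H: "subgroup H field_add_group"
    and A: "A = a0 <#\<^bsub>field_add_group\<^esub> H" and B1: "B1 = b0 <#\<^bsub>field_add_group\<^esub> H"
    and U: "U = {proj_point 0 a 1 | a. a \<notin> A} \<union> {proj_point 1 b 1 | b. b \<in> B1}"
  have le: "card H + 2 \<le> CARD('a)"
    using proper_divisor_add_2_le[OF d(1-3)] d(4) q by simp
  note res = additive_construction[OF le H, of a0 b0, folded l_coset_field_add_group[of a0]
      l_coset_field_add_group[of b0], folded A B1, folded U, unfolded d(4), folded q]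
  show "redei_blocking_set (U \<union> determined_directions U)"
    and "card (U \<union> determined_directions U) = 2 * q + 1 - d"
    by (fact res)+
qed

end
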